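(* Let $m\ge 1$ be an integer, $q=2^m$, and let $D_m=(f(x,y))_{x,y\in\mathbb{F}_q^2}$ be the $q^2\times q^2$ matrix whose entry at $x=(x_1,x_2)$, $y=(y_1,y_2)$ is $$f(x_1,x_2,y_1,y_2)=(x_1^2y_1+x_1y_1^2+x_2+y_2)^{q-1}.$$ Then $$\mathrm{rank}(D_m)\le \frac{1+\sqrt2}{2}(2+\sqrt2)^m,$$ and so $$R(D_m)\le \frac{1+\sqrt2}{2}\left(\frac{2+\sqrt2}{4}\right)^m .$$
   Context: $\mathbb{F}_q$ is the finite field with $q=2^m$ elements. The entries of $D_m$ lie in $\{0,1\}=\mathbb{F}_2\subseteq\mathbb{F}_q$, and rank means rank over $\mathbb{F}_2$ (equivalently over $\mathbb{F}_q$). For an $n\times n$ matrix $A$, its rate is $R(A)=\mathrm{rank}(A)/n$; thus $R(D_m)=\mathrm{rank}(D_m)/q^2$. *)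

theory Defs
  imports
    "HOL-Analysis.Analysis"
    "HOL-Computational_Algebra.Primes"
    "HOL-Library.Z2"
begin

text \<open>
  The type \<^typ>\<open>'a\<close> plays the role of the field with \<open>q = CARD('a)\<close> elements; rows and columns
  are indexed by pairs of field elements.
\<close>

definition D_mat :: "'a::finite_field ^ ('a \<times> 'a) ^ ('a \<times> 'a)" where
  "D_mat = (\<chi> x y. ((fst x)\<^sup>2 * fst y + fst x * (fst y)\<^sup>2 + snd x + snd y) ^ (CARD('a) - 1))"

text \<open>
  On the elements 0 and 1, this is the inverse of the inclusion \<open>of_bit\<close> of the two-element
  field \<^typ>\<open>bit\<close>. Its value elsewhere is immaterial here: all entries of \<open>D_mat\<close> are 0 or 1,
  so \<open>D_mat_F2\<close> below is \<open>D_mat\<close> read as a matrix over the two-element field.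
\<close>

definition to_bit :: "'a::zero_neq_one \<Rightarrow> bit" where
  "to_bit x = (if x = 0 then 0 else 1)"

lemma of_bit_to_bit: "x \<in> {0, 1} \<Longrightarrow> of_bit (to_bit x) = x"
  by (auto simp: to_bit_def)

lemma D_mat_entries: "D_mat $ x $ y \<in> {0, 1 :: 'a::finite_field}"
proof -
  define z where "z = (fst x)\<^sup>2 * fst y + fst x * (fst y)\<^sup>2 + snd x + snd y"
  have "card {0, 1 :: 'a} \<le> CARD('a)"
    by (intro card_mono) auto
  then have q: "CARD('a) = Suc (CARD('a) - 1)" "CARD('a) - 1 > 0"
    by auto
  have "z * z ^ (CARD('a) - 1) = z"
    using finite_field_power_card_eq_same[of z] q(1) by (metis power_Suc)
  then have "z ^ (CARD('a) - 1) \<in> {0, 1}"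
    using q(2) by (cases "z = 0") auto
  then show ?thesis
    by (simp add: D_mat_def z_def)
qed

definition D_mat_F2 :: "bit ^ ('a::finite_field \<times> 'a) ^ ('a \<times> 'a)" where
  "D_mat_F2 = map_matrix to_bit D_mat"

lemma map_matrix_of_bit_D_mat_F2:
  "map_matrix of_bit D_mat_F2 = (D_mat :: 'a::finite_field ^ ('a \<times> 'a) ^ ('a \<times> 'a))"
  by (simp only: D_mat_F2_def vec_eq_iff nth_map_matrix of_bit_to_bit[OF D_mat_entries] simp_thms)

definition matrix_rate :: "'a::field ^ 'n ^ 'n \<Rightarrow> real" where
  "matrix_rate A = real (rank A) / real CARD('n)"

end

theory Submission
  imports Defs
begin

text \<open>
  Since \<open>q - 1 = 1 + 2 + \<dots> + 2\<^sup>m\<^sup>-\<^sup>1\<close>, in characteristic 2 the entry is the product over \<open>i < m\<close> of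
  the \<open>2\<^sup>i\<close>-th powers of the four terms of the base. Hence each row is a combination of
  the monomials in \<open>y\<close> obtained by choosing one term for each \<open>i\<close>, and the rank is at most the number
  of distinct ones. The \<open>4\<^sup>m\<close> choices collide, because \<open>y\<^sub>1\<^sup>2\<close> at level \<open>i\<close> agrees with \<open>y\<^sub>1\<close>
  at level \<open>i + 1\<close>. Sorting the exponents by parity, the number of monomials and the number
  of monomials up to an optional extra factor \<open>y\<^sub>1\<close> satisfy a linear recursion whose matrix
  \<open>((2, 1), (2, 2))\<close> has the dominant eigenvalue \<open>2 + \<surd>2\<close>. Finally, vectors that
  are independent over a subfield stay independent over the larger field, so the bound
  descends to the two-element field.
\<close>

section \<open>Rank and field embeddings\<close>

lemma rank_le_card_span:
  fixes A :: "'a::field ^ 'n ^ 'm"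
  assumes "finite W" and "\<And>i. A $ i \<in> vec.span W"
  shows "rank A \<le> card W"
  unfolding row_rank_def_gen
  using assms by (intro vec.dim_le_card) (auto simp: rows_def row_def)

text \<open>The coordinate functional of \<open>b\<close> on \<open>B\<close>, written with explicit
  coefficients \<open>p\<close> so that a field embedding can act on them.\<close>

lemma independent_dual_coordinates:
  fixes B :: "('a::field ^ 'n) set"
  assumes "vec.independent B"
  obtains p :: "'a ^ 'n" where "\<And>v. v \<in> B \<Longrightarrow> (\<Sum>j\<in>UNIV. p $ j * v $ j) = (if v = b then 1 else 0)"
proof -
  obtain g :: "'a ^ 'n \<Rightarrow> 'a ^ 'n" where g: "Vector_Spaces.linear (*s) (*s) g"
    "\<And>v. v \<in> B \<Longrightarrow> g v = (if v = b then 1 else 0)"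
    using vec.linear_independent_extend[OF assms, of "\<lambda>v. if v = b then 1 else 0"] by blast
  \<comment> \<open>On \<open>B\<close> the values of \<open>g\<close> are the zero and the all-ones
    vector, so any row of its matrix serves; \<open>undefined\<close> merely picks one.\<close>
  have "(\<Sum>j\<in>UNIV. matrix g $ undefined $ j * v $ j) = g v $ undefined" for v
    by (simp flip: matrix_works[OF g(1)] add: matrix_vector_mult_def)
  with g(2) have "\<And>v. v \<in> B \<Longrightarrow> (\<Sum>j\<in>UNIV. matrix g $ undefined $ j * v $ j) = (if v = b then 1 else 0)"
    by simp
  then show thesis
    by (rule that)
qed

text \<open>Independent rows stay independent under \<open>h\<close>: the image of a dual functional
  still isolates a single coefficient of any relation over the larger field.\<close>

lemma rank_le_rank_map_matrix:
  fixes A :: "'a::field ^ 'n ^ 'm" and h :: "'a \<Rightarrow> 'b::field"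
  assumes h01: "h 0 = 0" "h 1 = 1"
    and hadd: "\<And>x y. h (x + y) = h x + h y"
    and hmult: "\<And>x y. h (x * y) = h x * h y"
  shows "rank A \<le> rank (map_matrix h A)"
proof -
  define lift :: "'a ^ 'n \<Rightarrow> 'b ^ 'n" where "lift = (\<lambda>v. \<chi> j. h (v $ j))"
  have hsum: "h (sum f S) = (\<Sum>x\<in>S. h (f x))" for f :: "'n \<Rightarrow> 'a" and S
    by (induction S rule: infinite_finite_induct) (simp_all add: h01 hadd)
  have "h x \<noteq> 0" if "x \<noteq> 0" for x
    using hmult[of x "inverse x"] that h01 by auto
  moreover have "h (x - y) = h x - h y" for x y
    using hadd[of "x - y" y] by simp
  ultimately have h_inj: "h x = h y \<Longrightarrow> x = y" for x y
    by (metis eq_iff_diff_eq_0)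
  then have inj: "inj_on lift S" for S
    by (auto simp: inj_on_def lift_def vec_eq_iff)
  obtain B where B: "B \<subseteq> rows A" "vec.independent B" "card B = vec.dim (rows A)"
    using vec.basis_exists by metis
  have fin: "finite B"
    using B(2) by (rule vec.finiteI_independent)
  have "vec.independent (lift ` B)"
  proof (rule vec.independent_if_scalars_zero)
    fix c w assume c: "(\<Sum>x\<in>lift ` B. c x *s x) = 0" and w: "w \<in> lift ` B"
    then obtain b where b: "b \<in> B" "w = lift b"
      by auto
    obtain p where p: "\<And>v. v \<in> B \<Longrightarrow> (\<Sum>j\<in>UNIV. p $ j * v $ j) = (if v = b then 1 else 0)"
      using independent_dual_coordinates[OF B(2)] by metis
    have "(\<Sum>v\<in>B. c (lift v) *s lift v) = 0"
      using c by (simp add: sum.reindex[OF inj])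
    then have "(\<Sum>v\<in>B. c (lift v) * h (v $ j)) = 0" for j
      by (simp add: vec_eq_iff lift_def)
    \<comment> \<open>Apply the functional with coefficients \<open>h (p $ j)\<close> to the
      relation.\<close>
    then have "0 = (\<Sum>j\<in>UNIV. h (p $ j) * (\<Sum>v\<in>B. c (lift v) * h (v $ j)))"
      by simp
    also have "\<dots> = (\<Sum>v\<in>B. c (lift v) * h (\<Sum>j\<in>UNIV. p $ j * v $ j))"
      unfolding sum_distrib_left hsum hmult
      by (subst sum.swap) (simp add: mult.left_commute)
    also have "\<dots> = (\<Sum>v\<in>B. if v = b then c (lift v) else 0)"
      by (intro sum.cong refl) (simp add: p h01)
    also have "\<dots> = c w"
      using b fin by simp
    finally show "c w = 0"
      by simp
  qed (use fin in simp)
  moreover have "lift ` B \<subseteq> rows (map_matrix h A)"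
  proof
    fix w assume "w \<in> lift ` B"
    then obtain i where "w = lift (row i A)"
      using B(1) by (auto simp: rows_def)
    also have "lift (row i A) = row i (map_matrix h A)"
      by (simp add: lift_def row_def vec_eq_iff)
    finally show "w \<in> rows (map_matrix h A)"
      by (auto simp: rows_def)
  qed
  ultimately have "card (lift ` B) \<le> vec.dim (rows (map_matrix h A))"
    by (intro vec.independent_card_le_dim)
  then show ?thesis
    by (simp add: row_rank_def_gen card_image[OF inj] B(3))
qed

section \<open>Counting the monomials\<close>

text \<open>Exponents of \<open>y\<^sub>1\<close> and \<open>y\<^sub>2\<close> that can occur in the
  power \<open>2 ^ k - 1\<close> of the base: squaring doubles them, and one more factor contributes
  \<open>y\<^sub>1\<^sup>2\<close>, \<open>y\<^sub>1\<close>, \<open>y\<^sub>2\<close> or a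
  constant.\<close>

primrec exponents :: "nat \<Rightarrow> (nat \<times> nat) set" where
  "exponents 0 = {(0, 0)}"
| "exponents (Suc k) =
    (\<Union>(e, g)\<in>exponents k. {(2 * e + 2, 2 * g), (2 * e + 1, 2 * g), (2 * e, 2 * g + 1), (2 * e, 2 * g)})"

definition exponents' :: "nat \<Rightarrow> (nat \<times> nat) set" where
  "exponents' k = exponents k \<union> (\<lambda>(e, g). (e + 1, g)) ` exponents k"

lemma finite_exponents: "finite (exponents k)"
  by (induction k) auto

lemma finite_exponents': "finite (exponents' k)"
  by (simp add: exponents'_def finite_exponents)

text \<open>The pairs with both entries even, \<open>(2 * e + 2, 2 * g)\<close> and
  \<open>(2 * e, 2 * g)\<close>, are doubles of elements of \<open>exponents' k\<close>; this is
  where choices collide.\<close>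

lemma card_exponents_Suc:
  "card (exponents (Suc k)) \<le> 2 * card (exponents k) + card (exponents' k)"
proof -
  let ?d = "\<lambda>a b (e, g). (2 * e + a, 2 * g + b) :: nat \<times> nat"
  have "exponents (Suc k) \<subseteq> ?d 1 0 ` exponents k \<union> ?d 0 1 ` exponents k \<union> ?d 0 0 ` exponents' k"
    (is "_ \<subseteq> ?R")
  proof
    fix p assume "p \<in> exponents (Suc k)"
    then obtain e g where "(e, g) \<in> exponents k"
      and "p \<in> {?d 0 0 (e + 1, g), ?d 1 0 (e, g), ?d 0 1 (e, g), ?d 0 0 (e, g)}"
      by (auto simp: exponents'_def)
    moreover from this have "(e, g) \<in> exponents' k" "(e + 1, g) \<in> exponents' k"
      by (force simp: exponents'_def)+
    ultimately show "p \<in> ?R"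
      by blast
  qed
  then have "card (exponents (Suc k)) \<le> card (?d 1 0 ` exponents k \<union> ?d 0 1 ` exponents k \<union> ?d 0 0 ` exponents' k)"
    by (intro card_mono) (auto simp: finite_exponents finite_exponents')
  also have "\<dots> \<le> card (?d 1 0 ` exponents k) + card (?d 0 1 ` exponents k) + card (?d 0 0 ` exponents' k)"
    by (meson add_mono card_Un_le le_refl order_trans)
  also have "\<dots> \<le> card (exponents k) + card (exponents k) + card (exponents' k)"
    by (intro add_mono card_image_le finite_exponents finite_exponents')
  finally show ?thesis
    by simp
qed

text \<open>One copy for each parity class: for odd second entry a copy of
  \<open>exponents k\<close>, for even second entry a copy of \<open>exponents' k\<close>.\<close>

lemma card_exponents'_Suc:
  "card (exponents' (Suc k)) \<le> 2 * card (exponents k) + 2 * card (exponents' k)"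
proof -
  let ?d = "\<lambda>a b (e, g). (2 * e + a, 2 * g + b) :: nat \<times> nat"
  have "exponents' (Suc k) \<subseteq>
      ?d 0 1 ` exponents k \<union> ?d 1 1 ` exponents k \<union> ?d 0 0 ` exponents' k \<union> ?d 1 0 ` exponents' k"
    (is "_ \<subseteq> ?R")
  proof
    fix p assume "p \<in> exponents' (Suc k)"
    then obtain e g where "(e, g) \<in> exponents k"
      and "p \<in> {?d 0 0 (e + 1, g), ?d 1 0 (e, g), ?d 0 1 (e, g), ?d 0 0 (e, g), ?d 1 0 (e + 1, g), ?d 1 1 (e, g)}"
      by (auto simp: exponents'_def)
    moreover from this have "(e, g) \<in> exponents' k" "(e + 1, g) \<in> exponents' k"
      by (force simp: exponents'_def)+
    ultimately show "p \<in> ?R"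
      by blast
  qed
  then have "card (exponents' (Suc k)) \<le>
      card (?d 0 1 ` exponents k \<union> ?d 1 1 ` exponents k \<union> ?d 0 0 ` exponents' k \<union> ?d 1 0 ` exponents' k)"
    by (intro card_mono) (auto simp: finite_exponents finite_exponents')
  also have "\<dots> \<le> card (?d 0 1 ` exponents k) + card (?d 1 1 ` exponents k)
      + card (?d 0 0 ` exponents' k) + card (?d 1 0 ` exponents' k)"
    by (meson add_mono card_Un_le le_refl order_trans)
  also have "\<dots> \<le> card (exponents k) + card (exponents k) + card (exponents' k) + card (exponents' k)"
    by (intro add_mono card_image_le finite_exponents finite_exponents')
  finally show ?thesis
    by simp
qed

text \<open>The eigenvectors are (1, \<open>sqrt 2\<close>) and (1, \<open>- sqrt 2\<close>), with
  eigenvalues \<open>2 + sqrt 2\<close> and \<open>2 - sqrt 2\<close>; the weights fit the initial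
  values 1 and 2.\<close>

lemma card_exponents_aux:
  "real (card (exponents k)) \<le> (1 + sqrt 2) / 2 * (2 + sqrt 2) ^ k + (1 - sqrt 2) / 2 * (2 - sqrt 2) ^ k \<and>
   real (card (exponents' k)) \<le> sqrt 2 * ((1 + sqrt 2) / 2 * (2 + sqrt 2) ^ k - (1 - sqrt 2) / 2 * (2 - sqrt 2) ^ k)"
proof (induction k)
  case 0
  then show ?case
    by (simp add: exponents'_def field_simps)
next
  case (Suc k)
  define a b where "a = (1 + sqrt 2) / 2 * (2 + sqrt 2) ^ k" and "b = (1 - sqrt 2) / 2 * (2 - sqrt 2) ^ k"
  have IH: "real (card (exponents k)) \<le> a + b" "real (card (exponents' k)) \<le> sqrt 2 * (a - b)"
    using Suc.IH by (simp_all add: a_def b_def)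
  have step: "(1 + sqrt 2) / 2 * (2 + sqrt 2) ^ Suc k = (2 + sqrt 2) * a"
    "(1 - sqrt 2) / 2 * (2 - sqrt 2) ^ Suc k = (2 - sqrt 2) * b"
    by (simp_all add: a_def b_def)
  have "real (card (exponents (Suc k))) \<le> 2 * (a + b) + sqrt 2 * (a - b)"
    using of_nat_mono[OF card_exponents_Suc[of k], where 'a = real] IH by simp
  moreover have "real (card (exponents' (Suc k))) \<le> 2 * (a + b) + 2 * (sqrt 2 * (a - b))"
    using of_nat_mono[OF card_exponents'_Suc[of k], where 'a = real] IH by simp
  moreover have "sqrt 2 * ((2 + sqrt 2) * a - (2 - sqrt 2) * b) = 2 * (a + b) + 2 * (sqrt 2 * (a - b))"
    by (simp add: algebra_simps)
  ultimately show ?case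
    unfolding step by (simp add: algebra_simps)
qed

lemma card_exponents_le: "real (card (exponents k)) \<le> (1 + sqrt 2) / 2 * (2 + sqrt 2) ^ k"
proof -
  have "1 \<le> sqrt 2" "sqrt 2 \<le> (2::real)"
    by (simp_all add: real_le_lsqrt)
  then have "(1 - sqrt 2) / 2 * (2 - sqrt 2) ^ k \<le> 0"
    by (intro mult_nonpos_nonneg) auto
  then show ?thesis
    using card_exponents_aux[of k] by linarith
qed

section \<open>The row space\<close>

definition monomial_vec :: "nat \<times> nat \<Rightarrow> 'a::finite_field ^ ('a \<times> 'a)" where
  "monomial_vec p = (\<chi> y. fst y ^ fst p * snd y ^ snd p)"

lemma two_eq_zero:
  assumes "CARD('a::finite_field) = 2 ^ m" "m \<ge> 1"
  shows "(2 :: 'a) = 0"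
proof -
  \<comment> \<open>Every element is fixed by the power \<open>q\<close>, and \<open>q\<close> is
    even.\<close>
  have "(-1 :: 'a) ^ (2 ^ m) = -1"
    using finite_field_power_card_eq_same[of "-1 :: 'a"] assms(1) by simp
  moreover have "(-1 :: 'a) ^ (2 ^ m) = 1"
    using assms(2) by simp
  ultimately show ?thesis
    by (metis add.right_inverse one_add_one)
qed

text \<open>Squaring is additive in characteristic 2, so no mixed products of monomials
  arise.\<close>

lemma span_mult_square:
  fixes v :: "'a::finite_field ^ ('a \<times> 'a)"
  assumes two: "(2 :: 'a) = 0"
    and v: "v \<in> vec.span (monomial_vec ` exponents k)"
  shows "(\<chi> y. (a\<^sup>2 * fst y + a * (fst y)\<^sup>2 + c + snd y) * (v $ y)\<^sup>2)
    \<in> vec.span (monomial_vec ` exponents (Suc k))"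
  using v
proof (induction rule: vec.span_induct_alt)
  case base
  then show ?case
    by (simp add: vec.span_zero flip: zero_vec_def)
next
  case (step t x v)
  let ?S = "vec.span (monomial_vec ` exponents (Suc k)) :: ('a ^ ('a \<times> 'a)) set"
  let ?z = "\<lambda>y. a\<^sup>2 * fst y + a * (fst y)\<^sup>2 + c + snd y"
  obtain e g where eg: "(e, g) \<in> exponents k" "x = monomial_vec (e, g)"
    using step(1) by auto
  have in_span: "monomial_vec p \<in> ?S"
    if "p \<in> {(2 * e + 2, 2 * g), (2 * e + 1, 2 * g), (2 * e, 2 * g + 1), (2 * e, 2 * g)}" for p
    using that eg(1) by (intro vec.span_base imageI) force
  have sq: "(r + s)\<^sup>2 = r\<^sup>2 + s\<^sup>2" for r s :: 'a
    by (simp add: power2_sum two)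
  have "(\<chi> y. ?z y * ((t *s x + v) $ y)\<^sup>2) =
      (t\<^sup>2 * a\<^sup>2) *s monomial_vec (2 * e + 1, 2 * g) + (t\<^sup>2 * a) *s monomial_vec (2 * e + 2, 2 * g)
      + (t\<^sup>2 * c) *s monomial_vec (2 * e, 2 * g) + t\<^sup>2 *s monomial_vec (2 * e, 2 * g + 1)
      + (\<chi> y. ?z y * (v $ y)\<^sup>2)"
    unfolding vec_eq_iff
    by (simp add: eg(2) monomial_vec_def sq power_mult_distrib power_even_eq)
      (simp add: power2_eq_square algebra_simps)
  also have "\<dots> \<in> ?S"
    using step by (intro vec.span_add vec.span_scale in_span) auto
  finally show ?case .
qed

lemma power_in_span:
  fixes a c :: "'a::finite_field"
  assumes "(2 :: 'a) = 0"
  shows "(\<chi> y. (a\<^sup>2 * fst y + a * (fst y)\<^sup>2 + c + snd y) ^ (2 ^ k - 1))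
    \<in> vec.span (monomial_vec ` exponents k)"
proof (induction k)
  case 0
  show ?case
    by (rule vec.span_base) (simp add: monomial_vec_def)
next
  case (Suc k)
  \<comment> \<open>The next power is the square of the previous one times one more factor of the
    base.\<close>
  have "2 ^ Suc k - 1 = Suc ((2 ^ k - 1) * 2 :: nat)"
    by (cases "2 ^ k :: nat") simp_all
  then show ?case
    using span_mult_square[OF assms Suc.IH, of a c] by (simp add: power_mult)
qed

lemma rank_D_mat_le:
  assumes "CARD('a::finite_field) = 2 ^ m" "m \<ge> 1"
  shows "real (rank (D_mat :: 'a ^ ('a \<times> 'a) ^ ('a \<times> 'a))) \<le> (1 + sqrt 2) / 2 * (2 + sqrt 2) ^ m"
proof -
  have "rank (D_mat :: 'a ^ ('a \<times> 'a) ^ ('a \<times> 'a))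
      \<le> card (monomial_vec ` exponents m :: ('a ^ ('a \<times> 'a)) set)"
    \<comment> \<open>The row at \<open>x\<close> is the case \<open>a = fst x\<close>,
      \<open>c = snd x\<close>, \<open>k = m\<close>.\<close>
    using power_in_span[OF two_eq_zero[OF assms]]
    by (intro rank_le_card_span) (simp_all add: D_mat_def assms(1) finite_exponents)
  also have "\<dots> \<le> card (exponents m)"
    by (intro card_image_le finite_exponents)
  finally show ?thesis
    using card_exponents_le[of m] by linarith
qed

lemma rank_D_mat_F2_le:
  assumes "(2 :: 'a::finite_field) = 0"
  shows "rank (D_mat_F2 :: bit ^ ('a \<times> 'a) ^ ('a \<times> 'a)) \<le> rank (D_mat :: 'a ^ ('a \<times> 'a) ^ ('a \<times> 'a))"
proof -
  \<comment> \<open>Characteristic 2 is what makes \<open>of_bit\<close> additive.\<close>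
  have "(1 :: 'a) + 1 = 0"
    using assms by simp
  then have add: "(of_bit (x + y) :: 'a) = of_bit x + of_bit y" for x y
    by (cases x; cases y) simp_all
  have mult: "(of_bit (x * y) :: 'a) = of_bit x * of_bit y" for x y
    by (cases x; cases y) simp_all
  show ?thesis
    unfolding map_matrix_of_bit_D_mat_F2[symmetric]
    by (rule rank_le_rank_map_matrix[OF _ _ add mult]) simp_all
qed

lemma matrix_rate_le:
  fixes A :: "'a::field ^ 'n ^ 'n"
  assumes "real CARD('n) = b ^ m" "b \<ge> 0" "real (rank A) \<le> c * r ^ m"
  shows "matrix_rate A \<le> c * (r / b) ^ m"
proof -
  have "matrix_rate A \<le> c * r ^ m / b ^ m"
    unfolding matrix_rate_def assms(1) using assms by (intro divide_right_mono) auto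
  then show ?thesis
    by (simp add: power_divide)
qed

theorem theorem2:
  fixes m :: nat
  assumes "m \<ge> 1"
    and "CARD('a::finite_field) = 2 ^ m"
  shows "real (rank (D_mat_F2 :: bit ^ ('a \<times> 'a) ^ ('a \<times> 'a))) \<le> (1 + sqrt 2) / 2 * (2 + sqrt 2) ^ m \<and>
         matrix_rate (D_mat_F2 :: bit ^ ('a \<times> 'a) ^ ('a \<times> 'a)) \<le> (1 + sqrt 2) / 2 * ((2 + sqrt 2) / 4) ^ m \<and>
         real (rank (D_mat :: 'a ^ ('a \<times> 'a) ^ ('a \<times> 'a))) \<le> (1 + sqrt 2) / 2 * (2 + sqrt 2) ^ m \<and>
         matrix_rate (D_mat :: 'a ^ ('a \<times> 'a) ^ ('a \<times> 'a)) \<le> (1 + sqrt 2) / 2 * ((2 + sqrt 2) / 4) ^ m"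
proof -
  have card: "real CARD('a \<times> 'a) = 4 ^ m"
    using assms(2) by (simp flip: power_mult_distrib)
  have "real (rank (D_mat :: 'a ^ ('a \<times> 'a) ^ ('a \<times> 'a))) \<le> (1 + sqrt 2) / 2 * (2 + sqrt 2) ^ m"
    using assms by (intro rank_D_mat_le)
  moreover from this have "real (rank (D_mat_F2 :: bit ^ ('a \<times> 'a) ^ ('a \<times> 'a))) \<le> (1 + sqrt 2) / 2 * (2 + sqrt 2) ^ m"
    using rank_D_mat_F2_le[OF two_eq_zero[OF assms(2,1)]] by linarith
  ultimately show ?thesis
    by (intro conjI matrix_rate_le card) auto
qed

end
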